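(* There exists a constant $c>0$ such that for every infinite sequence $(x_k)_{k=1}^{\infty}$ in $[0,1]$ there are infinitely many $n \in \mathbb{N}$ such that $$\min_{\pi \in S_n} \sum_{i=1}^{n} \left| x_{\pi(i)} - \frac{i}{n} \right| \geq c \sqrt{\log n}.$$
   Context: $S_n$ denotes the set of all permutations of $\{1,\dots,n\}$. *)

theory Defs
  imports Complex_Main "HOL-Combinatorics.Permutations"
begin

end

theory Submission
  imports Defs
begin

text \<open>
  The cost of the optimal matching is a discrepancy in the \<open>L\<^sup>1\<close> norm, and the proof is
  the Riesz product argument of Halasz, carried out on an integer grid. Only the indices
  \<open>n < 2 ^ m\<close> are considered, and \<open>x\<^sub>k\<close> is rounded down to a multiple of \<open>1 / T\<close> with
  \<open>T = 4 * 2 ^ m\<close>. This gives points \<open>(k, y\<^sub>k)\<close> in a grid of width \<open>2 ^ m\<close> and height \<open>T\<close>.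
  For each \<open>l < m\<close> divide the grid into dyadic boxes of size \<open>2 ^ (l + 1)\<close> times \<open>2 ^ (m - l)\<close>.
  There are twice as many boxes as points, so at least half of them contain no point. Let \<open>f\<^sub>l\<close>
  be the sum of the Haar functions of the empty boxes, and let
  \<open>F = (\<Prod>l<m. 1 + \<i> f\<^sub>l / sqrt m) - 1\<close>, which is bounded by 3.

  Since \<open>F\<close> is bounded, its partial sums in the second variable are Lipschitz, so the
  transport costs of the prefixes dominate the pairing of \<open>F\<close> with the discrepancy function.
  In this pairing the points contribute exactly zero, because every product of the \<open>f\<^sub>l\<close>
  vanishes on the boxes containing a point and has mean zero on the others. The
  remaining part is the pairing of \<open>F\<close> with \<open>n * s\<close>. Its terms linear in the \<open>f\<^sub>l\<close> add up
  to order \<open>sqrt m\<close> (after normalisation), while the terms whose extreme levels are \<open>k < l\<close>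
  decay like \<open>2 ^ k / 2 ^ l\<close> and are bounded in total. As \<open>ln n \<le> m\<close>, some \<open>n < 2 ^ m\<close> has the
  required cost, and \<open>n\<close> tends to infinity with \<open>m\<close> because the cost is at most \<open>n\<close>.
\<close>

section \<open>Sums against Haar functions in one and two variables\<close>

lemma div_pow2_coarsen:
  fixes x :: nat
  assumes "q \<le> p"
  shows "(2 ^ q * (x div 2 ^ q)) div 2 ^ p = x div 2 ^ p"
proof -
  obtain d where p: "p = q + d" using assms le_Suc_ex by blast
  show ?thesis unfolding p power_add by (simp add: div_mult2_eq)
qed

text \<open>The sign is 1 on the left half of a dyadic block and -1 on the right half, so each point
  is paired with its translate by \<open>2 ^ a\<close>.\<close>

lemma haar_block:
  fixes w :: "nat \<Rightarrow> complex"
  shows "(\<Sum>s\<in>{u * 2 ^ Suc a..<u * 2 ^ Suc a + 2 ^ Suc a}. w s * (-1) ^ (s div 2 ^ a))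
       = (\<Sum>j<2 ^ a. w (u * 2 ^ Suc a + j) - w (u * 2 ^ Suc a + 2 ^ a + j))"
proof -
  let ?B = "u * 2 ^ Suc a"
  let ?g = "\<lambda>s. w s * (-1) ^ (s div 2 ^ a)"
  have "sum ?g {?B..<?B + 2 ^ Suc a} = sum ?g {?B..<?B + 2 ^ a} + sum ?g {?B + 2 ^ a..<?B + 2 ^ a + 2 ^ a}"
    by (subst sum.atLeastLessThan_concat) (auto simp: mult_2 add.assoc)
  also have "sum ?g {?B..<?B + 2 ^ a} = (\<Sum>j<2 ^ a. w (?B + j))"
  proof (rule sum.reindex_bij_witness[of _ "\<lambda>j. ?B + j" "\<lambda>s. s - ?B"])
    fix s assume s: "s \<in> {?B..<?B + 2 ^ a}"
    then have "s div 2 ^ a = 2 * u"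
      by (intro div_nat_eqI) (auto simp: algebra_simps)
    with s show "w (?B + (s - ?B)) = ?g s" by simp
  qed auto
  also have "sum ?g {?B + 2 ^ a..<?B + 2 ^ a + 2 ^ a} = (\<Sum>j<2 ^ a. - w (?B + 2 ^ a + j))"
  proof (rule sum.reindex_bij_witness[of _ "\<lambda>j. ?B + 2 ^ a + j" "\<lambda>s. s - (?B + 2 ^ a)"])
    fix s assume s: "s \<in> {?B + 2 ^ a..<?B + 2 ^ a + 2 ^ a}"
    then have "s div 2 ^ a = 2 * u + 1"
      by (intro div_nat_eqI) (auto simp: algebra_simps)
    with s show "- w (?B + 2 ^ a + (s - (?B + 2 ^ a))) = ?g s" by simp
  qed auto
  finally show ?thesis by (simp add: sum_subtractf sum_negf)
qed

lemma haar_sum: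
  fixes w d :: "nat \<Rightarrow> complex"
  shows "(\<Sum>s<q * 2 ^ Suc a. d (s div 2 ^ Suc a) * w s * (-1) ^ (s div 2 ^ a))
       = (\<Sum>u<q. d u * (\<Sum>j<2 ^ a. w (u * 2 ^ Suc a + j) - w (u * 2 ^ Suc a + 2 ^ a + j)))"
  unfolding sum.nat_group[symmetric]
proof (rule sum.cong[OF refl])
  fix u
  have "(\<Sum>s = u * 2 ^ Suc a..<u * 2 ^ Suc a + 2 ^ Suc a. d (s div 2 ^ Suc a) * w s * (-1) ^ (s div 2 ^ a))
      = d u * (\<Sum>s = u * 2 ^ Suc a..<u * 2 ^ Suc a + 2 ^ Suc a. w s * (-1) ^ (s div 2 ^ a))"
    unfolding sum_distrib_left
  proof (rule sum.cong[OF refl])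
    fix s assume "s \<in> {u * 2 ^ Suc a..<u * 2 ^ Suc a + 2 ^ Suc a}"
    then have "s div 2 ^ Suc a = u" by (intro div_nat_eqI) (auto simp: algebra_simps)
    then show "d (s div 2 ^ Suc a) * w s * (-1) ^ (s div 2 ^ a) = d u * (w s * (-1) ^ (s div 2 ^ a))"
      by simp
  qed
  then show "(\<Sum>s = u * 2 ^ Suc a..<u * 2 ^ Suc a + 2 ^ Suc a. d (s div 2 ^ Suc a) * w s * (-1) ^ (s div 2 ^ a))
    = d u * (\<Sum>j<2 ^ a. w (u * 2 ^ Suc a + j) - w (u * 2 ^ Suc a + 2 ^ a + j))"
    by (simp only: haar_block)
qed

lemma haar_sum_const:
  fixes d :: "nat \<Rightarrow> complex"
  shows "(\<Sum>s<q * 2 ^ Suc a. d (s div 2 ^ Suc a) * (-1) ^ (s div 2 ^ a)) = 0"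
  using haar_sum[where w = "\<lambda>_. 1" and d = d and q = q and a = a] by simp

text \<open>Each block has \<open>2 ^ a\<close> pairs, and each pair contributes the translation
  length \<open>- (2 ^ a)\<close>.\<close>

lemma haar_sum_linear:
  fixes d :: "nat \<Rightarrow> complex"
  shows "(\<Sum>s<q * 2 ^ Suc a. d (s div 2 ^ Suc a) * of_nat s * (-1) ^ (s div 2 ^ a))
       = - (4 ^ a * (\<Sum>u<q. d u))"
proof -
  have "(4::complex) ^ a = 2 ^ a * 2 ^ a" by (simp add: power_mult_distrib[symmetric])
  then have "(\<Sum>j<2 ^ a. complex_of_nat (u * 2 ^ Suc a + j) - of_nat (u * 2 ^ Suc a + 2 ^ a + j)) = - (4 ^ a)" for u
    by simp
  then show ?thesis unfolding haar_sum by (simp add: sum_distrib_left mult.commute[of _ "4 ^ a"] sum_negf)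
qed

text \<open>Complete blocks below \<open>y\<close> cancel. Only the block cut by \<open>y\<close>
  survives, so the sum vanishes as soon as its coefficient does.\<close>

lemma haar_sum_partial:
  fixes d :: "nat \<Rightarrow> complex"
  shows "(\<Sum>s<y. d (s div 2 ^ Suc a) * (-1) ^ (s div 2 ^ a))
       = d (y div 2 ^ Suc a) * (\<Sum>s = y div 2 ^ Suc a * 2 ^ Suc a..<y. (-1) ^ (s div 2 ^ a))"
proof -
  let ?B = "y div 2 ^ Suc a * 2 ^ Suc a"
  let ?g = "\<lambda>s. d (s div 2 ^ Suc a) * (-1) ^ (s div 2 ^ a)"
  have le: "?B \<le> y" by (rule div_times_less_eq_dividend)
  have "sum ?g {..<y} = sum ?g {..<?B} + sum ?g {?B..<y}"
    by (subst sum.union_disjoint[symmetric]) (use order.strict_trans2[OF _ le] in \<open>auto intro!: sum.cong simp del: power_Suc\<close>)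
  also have "sum ?g {..<?B} = 0" by (rule haar_sum_const)
  also have "sum ?g {?B..<y} = (\<Sum>s = ?B..<y. d (y div 2 ^ Suc a) * (-1) ^ (s div 2 ^ a))"
  proof (rule sum.cong[OF refl])
    fix s assume s: "s \<in> {?B..<y}"
    have "s div 2 ^ Suc a = y div 2 ^ Suc a"
    proof (rule antisym)
      show "s div 2 ^ Suc a \<le> y div 2 ^ Suc a" using s by (intro div_le_mono) auto
      have "?B div 2 ^ Suc a \<le> s div 2 ^ Suc a" using s by (intro div_le_mono) auto
      then show "y div 2 ^ Suc a \<le> s div 2 ^ Suc a" by simp
    qed
    then show "?g s = d (y div 2 ^ Suc a) * (-1) ^ (s div 2 ^ a)" by simp
  qed
  finally show ?thesis by (simp add: sum_distrib_left)
qed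

text \<open>A combination of two-dimensional Haar functions with one coefficient per box. The linear
  terms and the higher products of the Riesz product both take this form, so their sums are computed
  once.\<close>

definition tile :: "nat \<Rightarrow> nat \<Rightarrow> (nat \<Rightarrow> nat \<Rightarrow> complex) \<Rightarrow> nat \<Rightarrow> nat \<Rightarrow> complex" where
  "tile a b c n s = c (n div 2 ^ Suc a) (s div 2 ^ Suc b) * (-1) ^ (n div 2 ^ a) * (-1) ^ (s div 2 ^ b)"

lemma tile_sum_zero: "(\<Sum>s<q * 2 ^ Suc b. tile a b c n s) = 0"
  using haar_sum_const[of "\<lambda>v. c (n div 2 ^ Suc a) v * (-1) ^ (n div 2 ^ a)" b q]
  by (simp add: tile_def)

text \<open>Summing over \<open>s < y\<close> leaves the row of boxes cut by \<open>y\<close>. The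
  sum over \<open>n \<ge> k\<close> is minus the sum over \<open>n < k\<close>, which leaves only
  the box containing \<open>(k, y)\<close>, whose coefficient is zero.\<close>

lemma tile_sum_corner:
  assumes "c (k div 2 ^ Suc a) (y div 2 ^ Suc b) = 0" and "k \<le> q * 2 ^ Suc a"
  shows "(\<Sum>n = k..<q * 2 ^ Suc a. \<Sum>s<y. tile a b c n s) = 0"
proof -
  define S where "S = (\<Sum>s = y div 2 ^ Suc b * 2 ^ Suc b..<y. (-1) ^ (s div 2 ^ b) :: complex)"
  define d where "d u = c u (y div 2 ^ Suc b) * S" for u
  let ?g = "\<lambda>n. d (n div 2 ^ Suc a) * (-1) ^ (n div 2 ^ a)"
  have inner: "(\<Sum>s<y. tile a b c n s) = ?g n" for n
    using haar_sum_partial[of "\<lambda>v. c (n div 2 ^ Suc a) v * (-1) ^ (n div 2 ^ a)" b y]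
    by (simp add: tile_def d_def S_def algebra_simps)
  have "sum ?g {..<q * 2 ^ Suc a} = sum ?g {..<k} + sum ?g {k..<q * 2 ^ Suc a}"
    by (subst sum.union_disjoint[symmetric]) (use assms(2) in \<open>auto intro!: sum.cong\<close>)
  moreover have "sum ?g {..<q * 2 ^ Suc a} = 0" by (rule haar_sum_const)
  moreover have "sum ?g {..<k} = 0" using assms(1) by (subst haar_sum_partial) (simp add: d_def)
  ultimately show ?thesis unfolding inner by simp
qed

text \<open>The sum factors over each box into \<open>- (4 ^ a)\<close> and
  \<open>- (4 ^ b)\<close>. The signs cancel, so nonnegative coefficients add up.\<close>

lemma tile_sum_bilinear:
  "(\<Sum>n<U * 2 ^ Suc a. \<Sum>s<V * 2 ^ Suc b. of_nat n * of_nat s * tile a b c n s)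
   = 4 ^ a * 4 ^ b * (\<Sum>u<U. \<Sum>v<V. c u v)"
proof -
  have "(\<Sum>s<V * 2 ^ Suc b. of_nat n * of_nat s * tile a b c n s)
      = - (4 ^ b) * ((\<Sum>v<V. c (n div 2 ^ Suc a) v) * of_nat n * (-1) ^ (n div 2 ^ a))" for n
  proof -
    have "(\<Sum>s<V * 2 ^ Suc b. of_nat n * of_nat s * tile a b c n s)
        = (of_nat n * (-1) ^ (n div 2 ^ a)) * (\<Sum>s<V * 2 ^ Suc b. c (n div 2 ^ Suc a) (s div 2 ^ Suc b) * of_nat s * (-1) ^ (s div 2 ^ b))"
      unfolding tile_def sum_distrib_left by (rule sum.cong[OF refl]) (simp only: mult_ac)
    then show ?thesis unfolding haar_sum_linear by (simp add: mult_ac)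
  qed
  then have "(\<Sum>n<U * 2 ^ Suc a. \<Sum>s<V * 2 ^ Suc b. of_nat n * of_nat s * tile a b c n s)
      = - (4 ^ b) * (\<Sum>n<U * 2 ^ Suc a. (\<Sum>v<V. c (n div 2 ^ Suc a) v) * of_nat n * (-1) ^ (n div 2 ^ a))"
    by (simp only: sum_distrib_left)
  also have "\<dots> = - (4 ^ b) * - (4 ^ a * (\<Sum>u<U. \<Sum>v<V. c u v))"
    using haar_sum_linear[of "\<lambda>u. \<Sum>v<V. c u v" a U] by simp
  finally show ?thesis by (simp only: minus_mult_minus mult_ac)
qed

text \<open>Terms are grouped by their largest index; the next lemma groups them by the smallest
  one.\<close>

lemma prod_one_plus_expand_right:
  fixes w :: "nat \<Rightarrow> 'a::comm_ring_1"
  shows "(\<Prod>j<m. 1 + w j) = 1 + (\<Sum>l<m. (\<Prod>j<l. 1 + w j) * w l)"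
  by (induction m) (simp_all add: algebra_simps)

lemma prod_one_plus_expand_left:
  fixes w :: "nat \<Rightarrow> 'a::comm_ring_1"
  shows "(\<Prod>j<l. 1 + w j) = 1 + (\<Sum>k<l. w k * (\<Prod>j\<in>{Suc k..<l}. 1 + w j))"
proof (induction l)
  case (Suc l)
  have "(\<Sum>k<Suc l. w k * (\<Prod>j\<in>{Suc k..<Suc l}. 1 + w j))
      = w l + (\<Sum>k<l. w k * (\<Prod>j\<in>{Suc k..<l}. 1 + w j) * (1 + w l))"
    by (auto simp: mult_ac intro!: sum.cong)
  also have "\<dots> = w l + (\<Sum>k<l. w k * (\<Prod>j\<in>{Suc k..<l}. 1 + w j)) * (1 + w l)"
    by (simp only: sum_distrib_right)
  finally show ?case using Suc by (simp add: algebra_simps)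
qed simp

section \<open>The Riesz product over empty dyadic boxes\<close>

locale riesz_product =
  fixes y :: "nat \<Rightarrow> nat" and m :: nat
  assumes m_pos: "m > 0"
begin

text \<open>Index 0 counts as a point too, so every column of boxes at level \<open>l\<close> holds
  exactly \<open>2 ^ (l + 1)\<close> points.\<close>

definition vacant :: "nat \<Rightarrow> nat \<Rightarrow> nat \<Rightarrow> bool" where
  "vacant l u v \<longleftrightarrow> (\<forall>i. i div 2 ^ Suc l = u \<longrightarrow> y i div 2 ^ (m - l) \<noteq> v)"

lemma not_vacant_point: "\<not> vacant l (i div 2 ^ Suc l) (y i div 2 ^ (m - l))"
  by (auto simp only: vacant_def)

definition f :: "nat \<Rightarrow> nat \<Rightarrow> nat \<Rightarrow> complex" where
  "f l n s = of_bool (vacant l (n div 2 ^ Suc l) (s div 2 ^ (m - l)))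
     * (-1) ^ (n div 2 ^ l) * (-1) ^ (s div 2 ^ (m - Suc l))"

text \<open>Being imaginary, it gives a factor modulus at most \<open>sqrt (1 + 1 / m)\<close>
  instead of \<open>1 + 1 / sqrt m\<close>, which keeps the product of \<open>m\<close> factors
  bounded.\<close>

definition z :: complex where
  "z = Complex 0 (1 / sqrt (real m))"

definition Q :: "nat \<Rightarrow> nat \<Rightarrow> nat \<Rightarrow> nat \<Rightarrow> complex" where
  "Q k l n s = (\<Prod>j\<in>{Suc k..<l}. 1 + z * f j n s)"

definition F :: "nat \<Rightarrow> nat \<Rightarrow> complex" where
  "F n s = (\<Prod>j<m. 1 + z * f j n s) - 1"

lemma norm_z: "cmod z = 1 / sqrt (real m)"
  by (simp add: z_def cmod_def)

lemma f_cases: "f l n s = 0 \<or> f l n s = 1 \<or> f l n s = -1"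
  by (cases "even (n div 2 ^ l)"; cases "even (s div 2 ^ (m - Suc l))") (auto simp: f_def)

lemma norm_factor_le: "cmod (1 + z * f l n s) \<le> exp (1 / (2 * real m))"
proof -
  have "cmod (1 + z * f l n s) \<le> 1 + 1 / (2 * real m)"
  proof (cases "f l n s = 0")
    case False
    then have "cmod (1 + z * f l n s) = sqrt (1 + 1 / real m)"
      using f_cases[of l n s] m_pos by (auto simp: z_def cmod_def power_divide)
    also have "\<dots> \<le> 1 + 1 / (2 * real m)"
      by (rule real_le_lsqrt) (use m_pos in \<open>auto simp: power2_eq_square field_simps\<close>)
    finally show ?thesis .
  qed simp
  also have "\<dots> \<le> exp (1 / (2 * real m))" by (rule exp_ge_add_one_self)
  finally show ?thesis .
qed

lemma norm_prod_le:
  assumes "J \<subseteq> {..<m}"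
  shows "cmod (\<Prod>j\<in>J. 1 + z * f j n s) \<le> 2"
proof -
  let ?e = "exp (1 / (2 * real m))"
  have "cmod (\<Prod>j\<in>J. 1 + z * f j n s) = (\<Prod>j\<in>J. cmod (1 + z * f j n s))"
    by (simp add: prod_norm)
  also have "\<dots> \<le> (\<Prod>j\<in>J. ?e)" by (intro prod_mono) (auto intro: norm_factor_le)
  also have "\<dots> = ?e ^ card J" by simp
  also have "\<dots> \<le> ?e ^ m"
    using card_mono[OF _ assms] by (intro power_increasing) auto
  also have "\<dots> = exp (1 / 2)" using m_pos by (simp add: exp_of_nat_mult[symmetric])
  also have "\<dots> \<le> 2"
  proof (rule power2_le_imp_le)
    have "exp (1 / 2 :: real) ^ 2 = exp 1" by (simp add: exp_of_nat_mult[symmetric])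
    then show "exp (1 / 2 :: real) ^ 2 \<le> 2 ^ 2" using exp_le by simp
  qed simp
  finally show ?thesis .
qed

lemma norm_Q_le: "l < m \<Longrightarrow> cmod (Q k l n s) \<le> 2"
  unfolding Q_def by (rule norm_prod_le) auto

lemma norm_F_le: "cmod (F n s) \<le> 3"
  unfolding F_def using norm_triangle_ineq4[of "\<Prod>j<m. 1 + z * f j n s" 1] norm_prod_le[of "{..<m}" n s]
  by simp

section \<open>Expansion of the Riesz product into tiles\<close>

lemma f_eq_tile: "l < m \<Longrightarrow> f l = tile l (m - Suc l) (\<lambda>u v. of_bool (vacant l u v))"
  by (intro ext) (simp add: f_def tile_def Suc_diff_Suc del: power_Suc)

definition outer :: "nat \<Rightarrow> nat \<Rightarrow> nat \<Rightarrow> nat \<Rightarrow> complex" where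
  "outer k l n s = of_bool (vacant k (n div 2 ^ Suc k) (s div 2 ^ (m - k))) * (-1) ^ (s div 2 ^ (m - Suc k))
     * Q k l n s * of_bool (vacant l (n div 2 ^ Suc l) (s div 2 ^ (m - l))) * (-1) ^ (n div 2 ^ l)"

text \<open>
  \<open>outer\<close> collects the factors of \<open>f k * Q k l * f l\<close> that are constant on boxes of size
  \<open>2 ^ (k + 1)\<close> times \<open>2 ^ (m - l)\<close>, so it can be read off at the lower left corner of the box.
\<close>

definition coef :: "nat \<Rightarrow> nat \<Rightarrow> nat \<Rightarrow> nat \<Rightarrow> complex" where
  "coef k l u v = outer k l (2 ^ Suc k * u) (2 ^ (m - l) * v)"

text \<open>A level \<open>j\<close> strictly between \<open>k\<close> and \<open>l\<close> sees
  \<open>n\<close> only at scales that are multiples of \<open>2 ^ (k + 1)\<close> and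
  \<open>s\<close> only at multiples of \<open>2 ^ (m - l)\<close>, so rounding to the corner
  changes nothing.\<close>

lemma coef_div:
  assumes "k < l" "l < m"
  shows "coef k l (n div 2 ^ Suc k) (s div 2 ^ (m - l)) = outer k l n s"
proof -
  have f_coarse: "f j (2 ^ Suc k * (n div 2 ^ Suc k)) (2 ^ (m - l) * (s div 2 ^ (m - l))) = f j n s"
    if "k < j" "j < l" for j
    unfolding f_def using that assms by (simp add: div_pow2_coarsen del: power_Suc)
  have Q_coarse: "Q k l (2 ^ Suc k * (n div 2 ^ Suc k)) (2 ^ (m - l) * (s div 2 ^ (m - l))) = Q k l n s"
    unfolding Q_def by (rule prod.cong) (simp_all add: f_coarse del: power_Suc)
  show ?thesis
    unfolding coef_def outer_def Q_coarse using assms by (simp add: div_pow2_coarsen del: power_Suc)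
qed

text \<open>The finest sign in \<open>n\<close> comes from the lowest level \<open>k\<close>, the
  finest sign in \<open>s\<close> from the highest level \<open>l\<close>; all else is constant on
  the resulting boxes.\<close>

lemma product_eq_tile:
  assumes "k < l" "l < m"
  shows "f k n s * Q k l n s * f l n s = tile k (m - Suc l) (coef k l) n s"
  unfolding tile_def using assms coef_div[OF assms, of n s]
  by (simp add: Suc_diff_Suc outer_def f_def mult_ac del: power_Suc)

lemma norm_coef_le: "l < m \<Longrightarrow> cmod (coef k l u v) \<le> 2"
  unfolding coef_def outer_def using norm_Q_le by (simp add: norm_mult norm_power)

text \<open>A box containing a point lies in a level \<open>k\<close> box that is not
  vacant.\<close>

lemma coef_point:
  assumes "k < l" "l < m"
  shows "coef k l (i div 2 ^ Suc k) (y i div 2 ^ (m - l)) = 0"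
  unfolding coef_div[OF assms] outer_def using not_vacant_point[of k i] by simp

text \<open>Nonlinear terms are sorted by their extreme levels \<open>k < l\<close>. The factors in
  between stay multiplied together in \<open>Q\<close>, which is bounded by 2.\<close>

lemma F_expand:
  "F n s = (\<Sum>l<m. z * f l n s) + (\<Sum>l<m. \<Sum>k<l. z\<^sup>2 * (f k n s * Q k l n s * f l n s))"
proof -
  define w where "w j = z * f j n s" for j
  have Q: "Q k l n s = (\<Prod>j\<in>{Suc k..<l}. 1 + w j)" for k l by (simp add: Q_def w_def)
  have "F n s = (\<Sum>l<m. (\<Prod>j<l. 1 + w j) * w l)"
    using prod_one_plus_expand_right[of w m] by (simp add: F_def w_def)
  also have "\<dots> = (\<Sum>l<m. z * f l n s + (\<Sum>k<l. z\<^sup>2 * (f k n s * Q k l n s * f l n s)))"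
  proof (rule sum.cong[OF refl])
    fix l
    have "(\<Prod>j<l. 1 + w j) * w l = w l + (\<Sum>k<l. w k * Q k l n s) * w l"
      unfolding Q using prod_one_plus_expand_left[of w l] by (simp add: distrib_right)
    also have "(\<Sum>k<l. w k * Q k l n s) * w l = (\<Sum>k<l. z\<^sup>2 * (f k n s * Q k l n s * f l n s))"
      unfolding sum_distrib_right w_def
      by (rule sum.cong[OF refl]) (simp add: power2_eq_square mult_ac)
    finally show "(\<Prod>j<l. 1 + w j) * w l = z * f l n s + (\<Sum>k<l. z\<^sup>2 * (f k n s * Q k l n s * f l n s))"
      by (simp add: w_def)
  qed
  finally show ?thesis by (simp only: sum.distrib)
qed

text \<open>Serves with weight 1 for the vanishing sums and with weight \<open>n * s\<close> for the
  volume term.\<close>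

lemma sum_F_expand:
  "(\<Sum>n\<in>A. \<Sum>s\<in>B. w n s * F n s)
   = (\<Sum>l<m. z * (\<Sum>n\<in>A. \<Sum>s\<in>B. w n s * f l n s))
     + (\<Sum>l<m. \<Sum>k<l. z\<^sup>2 * (\<Sum>n\<in>A. \<Sum>s\<in>B. w n s * (f k n s * Q k l n s * f l n s)))"
proof -
  define L where "L P = (\<Sum>n\<in>A. \<Sum>s\<in>B. w n s * P n s)" for P :: "nat \<Rightarrow> nat \<Rightarrow> complex"
  have add: "L (\<lambda>n s. P n s + P' n s) = L P + L P'" for P P'
    by (simp add: L_def sum.distrib distrib_left)
  have scale: "L (\<lambda>n s. c * P n s) = c * L P" for P c
    by (simp add: L_def sum_distrib_left mult_ac)
  have sum: "L (\<lambda>n s. \<Sum>i\<in>I. P i n s) = (\<Sum>i\<in>I. L (P i))" for P and I :: "nat set"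
    unfolding L_def sum_distrib_left by (simp only: sum.swap[of _ B I] sum.swap[of _ A I])
  have "L F = L (\<lambda>n s. (\<Sum>l<m. z * f l n s) + (\<Sum>l<m. \<Sum>k<l. z\<^sup>2 * (f k n s * Q k l n s * f l n s)))"
    by (simp add: F_expand[abs_def])
  also have "\<dots> = (\<Sum>l<m. z * L (f l)) + (\<Sum>l<m. \<Sum>k<l. z\<^sup>2 * L (\<lambda>n s. f k n s * Q k l n s * f l n s))"
    by (simp only: add sum scale)
  finally show ?thesis unfolding L_def .
qed

section \<open>Vanishing sums of the Riesz product\<close>

lemma grid_height:
  assumes "l < m"
  shows "4 * 2 ^ m = 2 ^ (l + 2) * (2 ^ Suc (m - Suc l) :: nat)"
proof -
  have "l + 2 + Suc (m - Suc l) = 2 + m" using assms by simp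
  then have "2 ^ (l + 2) * (2 ^ Suc (m - Suc l) :: nat) = 2 ^ (2 + m)" by (metis power_add)
  then show ?thesis by simp
qed

lemma grid_width:
  assumes "l < m"
  shows "2 ^ m = 2 ^ (m - Suc l) * (2 ^ Suc l :: nat)"
proof -
  have "m - Suc l + Suc l = m" using assms by simp
  then show ?thesis by (metis power_add)
qed

lemma sum_F_zero: "(\<Sum>s<4 * 2 ^ m. F n s) = 0"
proof -
  have 1: "(\<Sum>s<4 * 2 ^ m. f l n s) = 0" if "l < m" for l
    unfolding grid_height[OF that] f_eq_tile[OF that] by (rule tile_sum_zero)
  have 2: "(\<Sum>s<4 * 2 ^ m. f k n s * Q k l n s * f l n s) = 0" if "k < l" "l < m" for k l
    unfolding grid_height[OF that(2)] product_eq_tile[OF that] by (rule tile_sum_zero)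
  have "(\<Sum>s<4 * 2 ^ m. F n s) = (\<Sum>n\<in>{n}. \<Sum>s<4 * 2 ^ m. 1 * F n s)" by simp
  also have "\<dots> = 0" unfolding sum_F_expand by (simp add: 1 2)
  finally show ?thesis .
qed

text \<open>Point \<open>i\<close> belongs to the prefixes \<open>n \<ge> i\<close>, so this is its
  total contribution to the pairing. Every tile of the expansion has coefficient zero on the box
  containing \<open>(i, y i)\<close>.\<close>

lemma sum_F_point: "(\<Sum>n = i..<2 ^ m. \<Sum>s<y i. F n s) = 0"
proof (cases "i \<le> 2 ^ m")
  case True
  have 1: "(\<Sum>n = i..<2 ^ m. \<Sum>s<y i. f l n s) = 0" if "l < m" for l
  proof -
    have "i \<le> 2 ^ (m - Suc l) * 2 ^ Suc l" using True grid_width[OF that] by simp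
    moreover have "of_bool (vacant l (i div 2 ^ Suc l) (y i div 2 ^ Suc (m - Suc l))) = (0::complex)"
      using not_vacant_point[of l i] that by (simp only: Suc_diff_Suc of_bool_eq)
    ultimately show ?thesis
      unfolding f_eq_tile[OF that] grid_width[OF that] by (intro tile_sum_corner)
  qed
  have 2: "(\<Sum>n = i..<2 ^ m. \<Sum>s<y i. f k n s * Q k l n s * f l n s) = 0" if kl: "k < l" "l < m" for k l
  proof -
    have km: "k < m" using kl by simp
    have "i \<le> 2 ^ (m - Suc k) * 2 ^ Suc k" using True grid_width[OF km] by simp
    moreover have "coef k l (i div 2 ^ Suc k) (y i div 2 ^ Suc (m - Suc l)) = 0"
      using coef_point[OF kl, of i] kl(2) by (simp only: Suc_diff_Suc)
    ultimately show ?thesis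
      unfolding product_eq_tile[OF kl] grid_width[OF km] by (intro tile_sum_corner)
  qed
  have "(\<Sum>n = i..<2 ^ m. \<Sum>s<y i. F n s) = (\<Sum>n = i..<2 ^ m. \<Sum>s<y i. 1 * F n s)" by simp
  also have "\<dots> = 0" unfolding sum_F_expand by (simp add: 1 2)
  finally show ?thesis .
qed simp

section \<open>Lower bound for the volume term\<close>

lemma card_vacant:
  assumes "l < m"
  shows "2 ^ Suc l \<le> card ({..<2 ^ (l + 2)} \<inter> {v. vacant l u v})"
proof -
  let ?V = "{..<2 ^ (l + 2)} \<inter> {v. vacant l u v}"
  let ?I = "{u * 2 ^ Suc l..<u * 2 ^ Suc l + 2 ^ Suc l}"
  \<comment> \<open>A column has \<open>2 ^ (l + 2)\<close> boxes but only
    \<open>2 ^ (l + 1)\<close> indices, each occupying at most one of them.\<close>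
  have "{..<2 ^ (l + 2)} \<subseteq> ?V \<union> (\<lambda>i. y i div 2 ^ (m - l)) ` ?I"
  proof
    fix v :: nat assume v: "v \<in> {..<2 ^ (l + 2)}"
    show "v \<in> ?V \<union> (\<lambda>i. y i div 2 ^ (m - l)) ` ?I"
    proof (cases "vacant l u v")
      case False
      then obtain i where i: "i div 2 ^ Suc l = u" "y i div 2 ^ (m - l) = v"
        by (auto simp: vacant_def)
      have "i = u * 2 ^ Suc l + i mod 2 ^ Suc l" unfolding i(1)[symmetric] by (rule div_mult_mod_eq[symmetric])
      moreover have "i mod 2 ^ Suc l < 2 ^ Suc l" by simp
      ultimately have "i \<in> ?I" unfolding atLeastLessThan_iff by linarith
      with i(2) show ?thesis by blast
    qed (use v in auto)
  qed
  then have "card {..<(2::nat) ^ (l + 2)} \<le> card (?V \<union> (\<lambda>i. y i div 2 ^ (m - l)) ` ?I)"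
    by (intro card_mono) auto
  also have "\<dots> \<le> card ?V + card ((\<lambda>i. y i div 2 ^ (m - l)) ` ?I)" by (rule card_Un_le)
  also have "\<dots> \<le> card ?V + card ?I" by (intro add_mono card_image_le) auto
  finally show ?thesis by simp
qed

text \<open>At least \<open>2 ^ m\<close> boxes are empty over all columns, and each one weighs
  \<open>4 ^ (m - 1)\<close>.\<close>

lemma volume_f:
  assumes "l < m"
  shows "8 ^ m / 4 \<le> Re (\<Sum>n<2 ^ m. \<Sum>s<4 * 2 ^ m. of_nat n * of_nat s * f l n s)"
proof -
  define K where "K = (\<Sum>u<2 ^ (m - Suc l). card ({..<2 ^ (l + 2)} \<inter> {v. vacant l u v}))"
  have p: "m = Suc (l + (m - Suc l))" using assms by simp
  have "(\<Sum>u<(2::nat) ^ (m - Suc l). 2 ^ Suc l) \<le> K"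
    unfolding K_def by (intro sum_mono card_vacant assms)
  then have "2 ^ m \<le> K" using grid_width[OF assms] by simp
  then have K: "2 ^ m \<le> real K" by (metis of_nat_le_iff of_nat_numeral of_nat_power)
  have eq: "(\<Sum>n<2 ^ m. \<Sum>s<4 * 2 ^ m. of_nat n * of_nat s * f l n s) = of_real (4 ^ m / 4 * real K)"
  proof -
    have "(\<Sum>n<2 ^ m. \<Sum>s<4 * 2 ^ m. of_nat n * of_nat s * f l n s)
      = 4 ^ l * 4 ^ (m - Suc l) * (\<Sum>u<2 ^ (m - Suc l). \<Sum>v<2 ^ (l + 2). of_bool (vacant l u v))"
      unfolding f_eq_tile[OF assms] grid_height[OF assms]
      by (subst grid_width[OF assms]) (rule tile_sum_bilinear)
    also have "(\<Sum>u<2 ^ (m - Suc l). \<Sum>v<2 ^ (l + 2). of_bool (vacant l u v)) = complex_of_nat K"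
      by (simp add: K_def sum_of_bool_eq)
    also have "4 ^ l * 4 ^ (m - Suc l) = (4 ^ m / 4 :: complex)"
      by (subst (2) p) (simp add: power_add)
    finally show ?thesis by simp
  qed
  have "(8::real) ^ m / 4 = 4 ^ m / 4 * 2 ^ m" by (simp add: power_mult_distrib[symmetric])
  also have "\<dots> \<le> 4 ^ m / 4 * real K" using K by (intro mult_left_mono) auto
  finally show ?thesis unfolding eq by simp
qed

text \<open>There are \<open>2 ^ (m - k - 1) * 2 ^ (l + 2)\<close> boxes of weight
  \<open>4 ^ k * 4 ^ (m - l - 1)\<close> with coefficients bounded by 2. The small boxes give the
  decay in \<open>l - k\<close>.\<close>

lemma volume_product:
  assumes "k < l" "l < m"
  shows "cmod (\<Sum>n<2 ^ m. \<Sum>s<4 * 2 ^ m. of_nat n * of_nat s * (f k n s * Q k l n s * f l n s))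
    \<le> 8 ^ m * (2 ^ k / 2 ^ l)"
proof -
  have km: "k < m" using assms by simp
  define d where "d = l - Suc k"
  define e where "e = m - Suc l"
  have l: "l = Suc (k + d)" and m: "m = Suc (Suc (k + d + e))" using assms by (auto simp: d_def e_def)
  have "cmod (\<Sum>u<2 ^ (m - Suc k). \<Sum>v<2 ^ (l + 2). coef k l u v) \<le> (\<Sum>u<(2::nat) ^ (m - Suc k). \<Sum>v<(2::nat) ^ (l + 2). 2)"
    by (intro sum_norm_le norm_coef_le assms(2))
  also have "\<dots> = 2 ^ (m - Suc k) * 2 ^ (l + 2) * 2" by simp
  finally have "4 ^ k * 4 ^ (m - Suc l) * cmod (\<Sum>u<2 ^ (m - Suc k). \<Sum>v<2 ^ (l + 2). coef k l u v)
      \<le> 4 ^ k * 4 ^ (m - Suc l) * (2 ^ (m - Suc k) * 2 ^ (l + 2) * 2)"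
    by (intro mult_left_mono) auto
  also have "\<dots> = 8 ^ m * (2 ^ k / 2 ^ l)"
  proof -
    have 4: "(4::real) ^ i = 2 ^ i * 2 ^ i" for i by (simp add: power_mult_distrib[symmetric])
    have 8: "(8::real) ^ i = 2 ^ i * 2 ^ i * 2 ^ i" for i by (simp add: power_mult_distrib[symmetric])
    show ?thesis unfolding 4 8 l m by (simp add: power_add field_simps)
  qed
  also have "4 ^ k * 4 ^ (m - Suc l) * cmod (\<Sum>u<2 ^ (m - Suc k). \<Sum>v<2 ^ (l + 2). coef k l u v)
    = cmod (\<Sum>n<2 ^ m. \<Sum>s<4 * 2 ^ m. of_nat n * of_nat s * (f k n s * Q k l n s * f l n s))"
    unfolding product_eq_tile[OF assms] grid_height[OF assms(2)]
    by (subst grid_width[OF km]) (simp only: tile_sum_bilinear norm_mult norm_power norm_numeral)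
  finally show ?thesis .
qed

text \<open>The \<open>m\<close> linear terms share the factor \<open>z\<close> and do not cancel,
  since their real parts are positive. For the others \<open>\<bar>z\<bar>\<close> squared is
  \<open>1 / m\<close>, and a geometric series bounds each \<open>l\<close>, so they total at most
  \<open>8 ^ m\<close>.\<close>

lemma volume_F_ge:
  "8 ^ m * (sqrt (real m) / 4 - 1) \<le> cmod (\<Sum>n<2 ^ m. \<Sum>s<4 * 2 ^ m. of_nat n * of_nat s * F n s)"
proof -
  define D where "D l = (\<Sum>n<2 ^ m. \<Sum>s<4 * 2 ^ m. of_nat n * of_nat s * f l n s)" for l
  define E where "E k l = (\<Sum>n<2 ^ m. \<Sum>s<4 * 2 ^ m. of_nat n * of_nat s * (f k n s * Q k l n s * f l n s))" for k l
  have "real m * (8 ^ m / 4) = (\<Sum>l<m. 8 ^ m / 4)" by simp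
  also have "\<dots> \<le> (\<Sum>l<m. Re (D l))" unfolding D_def by (intro sum_mono volume_f) simp
  also have "\<dots> = Re (\<Sum>l<m. D l)" by simp
  also have "\<dots> \<le> cmod (\<Sum>l<m. D l)" by (rule complex_Re_le_cmod)
  finally have "real m * (8 ^ m / 4) \<le> cmod (\<Sum>l<m. D l)" .
  then have "cmod z * (real m * (8 ^ m / 4)) \<le> cmod z * cmod (\<Sum>l<m. D l)"
    by (rule mult_left_mono) simp
  also have "\<dots> = cmod (\<Sum>l<m. z * D l)"
    by (simp add: norm_mult flip: sum_distrib_left)
  finally have "cmod z * (real m * (8 ^ m / 4)) \<le> cmod (\<Sum>l<m. z * D l)" .
  moreover have "cmod z * real m = sqrt (real m)" by (simp add: norm_z real_div_sqrt)
  then have "cmod z * (real m * (8 ^ m / 4)) = 8 ^ m * (sqrt (real m) / 4)" by simp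
  ultimately have main: "8 ^ m * (sqrt (real m) / 4) \<le> cmod (\<Sum>l<m. z * D l)" by (simp only:)
  have inner: "(\<Sum>k<l. 2 ^ k / 2 ^ l :: real) \<le> 1" for l
  proof -
    have "(\<Sum>k<l. 2 ^ k :: real) = 2 ^ l - 1" by (induction l) auto
    then show ?thesis by (simp flip: sum_divide_distrib)
  qed
  have "cmod (\<Sum>l<m. \<Sum>k<l. z\<^sup>2 * E k l) \<le> (\<Sum>l<m. \<Sum>k<l. 1 / m * (8 ^ m * (2 ^ k / 2 ^ l)))"
  proof (intro sum_norm_le)
    fix l k assume "l \<in> {..<m}" "k \<in> {..<l}"
    then have "cmod (E k l) \<le> 8 ^ m * (2 ^ k / 2 ^ l)" unfolding E_def by (intro volume_product) auto
    moreover have "cmod (z\<^sup>2) = 1 / m" by (simp add: norm_power norm_z power_divide)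
    ultimately show "cmod (z\<^sup>2 * E k l) \<le> 1 / m * (8 ^ m * (2 ^ k / 2 ^ l))"
      unfolding norm_mult by (simp only: mult_left_mono zero_le_divide_1_iff of_nat_0_le_iff)
  qed
  also have "\<dots> = 8 ^ m / m * (\<Sum>l<m. \<Sum>k<l. 2 ^ k / 2 ^ l)"
    by (simp add: sum_distrib_left)
  also have "\<dots> \<le> 8 ^ m / m * (\<Sum>l<m. 1)"
    by (intro mult_left_mono sum_mono inner) auto
  also have "\<dots> = 8 ^ m" using m_pos by simp
  finally have "cmod (\<Sum>l<m. \<Sum>k<l. z\<^sup>2 * E k l) \<le> 8 ^ m" .
  with main have "8 ^ m * (sqrt (real m) / 4 - 1) \<le> cmod ((\<Sum>l<m. z * D l) + (\<Sum>l<m. \<Sum>k<l. z\<^sup>2 * E k l))"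
    using norm_diff_ineq[of "\<Sum>l<m. z * D l" "\<Sum>l<m. \<Sum>k<l. z\<^sup>2 * E k l"]
    by (simp add: right_diff_distrib)
  then show ?thesis unfolding sum_F_expand D_def E_def .
qed

end

section \<open>From matching costs to the Riesz product\<close>

lemma card_grid:
  fixes n s T :: nat
  assumes "1 \<le> n" "n \<le> T" "s < T"
  shows "\<bar>real (card {i \<in> {1..n}. s < T * i div n}) - (real n - real n * real s / real T)\<bar> \<le> 1"
proof -
  \<comment> \<open>The largest index whose rounded target is still at most \<open>s\<close>, so
    exactly \<open>n - r\<close> targets exceed \<open>s\<close>.\<close>
  define r where "r = (Suc s * n - 1) div T"
  have T: "0 < T" and pos: "1 \<le> Suc s * n" using assms by auto
  have "s < T * i div n \<longleftrightarrow> Suc r \<le> i" for i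
  proof -
    have "s < T * i div n \<longleftrightarrow> Suc s * n \<le> T * i"
      using assms(1) less_eq_div_iff_mult_less_eq[of n "Suc s" "T * i"] by (simp add: Suc_le_eq)
    also have "\<dots> \<longleftrightarrow> \<not> i * T \<le> Suc s * n - 1" using pos by (simp only: mult.commute) linarith
    also have "\<dots> \<longleftrightarrow> \<not> i \<le> r" unfolding r_def using T by (simp only: less_eq_div_iff_mult_less_eq)
    finally show ?thesis by auto
  qed
  then have "card {i \<in> {1..n}. s < T * i div n} = card {i \<in> {1..n}. Suc r \<le> i}" by (simp only:)
  also have "{i \<in> {1..n}. Suc r \<le> i} = {Suc r..n}" by auto
  finally have card: "card {i \<in> {1..n}. s < T * i div n} = n - r" by simp
  have r1: "r * T \<le> Suc s * n - 1" unfolding r_def by (rule div_times_less_eq_dividend)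
  then have "r * T < Suc s * n" using pos by linarith
  also have "\<dots> \<le> T * n" using assms(3) by (intro mult_right_mono) auto
  finally have "r < n" by (simp add: mult.commute)
  have "Suc s * n - 1 < Suc r * T"
    unfolding r_def using T dividend_less_div_times[of T "Suc s * n - 1"] by (simp add: algebra_simps)
  then have r2: "Suc s * n \<le> Suc r * T" by linarith
  have "real (r * T) \<le> real (Suc s * n)" using r1 by (intro of_nat_mono) linarith
  then have "real r * real T \<le> (real s + 1) * real n" by (simp add: algebra_simps)
  then have u: "real r \<le> real n * real s / real T + 1"
    using T assms(2) by (simp add: field_simps)
  have "real (Suc s * n) \<le> real (Suc r * T)" using r2 by (intro of_nat_mono)
  then have "real s * real n \<le> (real r + 1) * real T" by (simp add: algebra_simps)
  then have l: "real n * real s / real T \<le> real r + 1"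
    using T by (simp add: field_simps)
  show ?thesis using u l \<open>r < n\<close> unfolding card by (simp add: of_nat_diff abs_le_iff)
qed

context riesz_product
begin

abbreviation T :: nat where "T \<equiv> 4 * 2 ^ m"

text \<open>A test function as in Kantorovich duality: it is Lipschitz with constant 3, so
  differences of its sums bound transport costs from below.\<close>

definition G :: "nat \<Rightarrow> nat \<Rightarrow> complex" where
  "G n j = (\<Sum>s<j. F n s)"

lemma G_lipschitz: "cmod (G n i - G n j) \<le> 3 * \<bar>real i - real j\<bar>"
proof -
  have *: "cmod (G n j - G n i) \<le> 3 * \<bar>real j - real i\<bar>" if "i \<le> j" for i j
  proof -
    have "G n j - G n i = (\<Sum>s = i..<j. F n s)"
      unfolding G_def lessThan_atLeast0 using that by (simp add: sum_diff_nat_ivl)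
    also have "cmod \<dots> \<le> (\<Sum>s = i..<j. 3)" by (intro sum_norm_le norm_F_le)
    finally show ?thesis using that by (simp add: of_nat_diff mult.commute)
  qed
  show ?thesis
    using *[of i j] *[of j i] by (cases "i \<le> j") (auto simp: norm_minus_commute abs_minus_commute)
qed

text \<open>Exchanging sums turns the targets into their count above \<open>s\<close>, which is
  \<open>n - n * s / T\<close> up to 1. The part \<open>n\<close> drops out by the zero mean of
  \<open>F\<close>, and \<open>T\<close> errors of at most 3 remain.\<close>

lemma G_grid:
  assumes "1 \<le> n" "n \<le> T"
  shows "cmod ((\<Sum>i = 1..n. G n (T * i div n)) + (\<Sum>s<T. of_nat n * of_nat s * F n s) / of_nat T) \<le> 3 * real T"
proof -
  define c where "c s = card {i \<in> {1..n}. s < T * i div n}" for s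
  have "G n (T * i div n) = (\<Sum>s<T. F n s * of_bool (s < T * i div n))" if "i \<in> {1..n}" for i
  proof -
    have "T * i div n \<le> T * n div n" using that by (intro div_le_mono mult_left_mono) auto
    then have le: "T * i div n \<le> T" using assms(1) by simp
    have "{..<T * i div n} = {..<T} \<inter> {s. s < T * i div n}" using le by auto
    then show ?thesis
      unfolding G_def by (simp add: sum.inter_restrict of_bool_def if_distrib cong: if_cong)
  qed
  then have "(\<Sum>i = 1..n. G n (T * i div n)) = (\<Sum>i = 1..n. \<Sum>s<T. F n s * of_bool (s < T * i div n))"
    by (intro sum.cong) auto
  also have "\<dots> = (\<Sum>s<T. \<Sum>i = 1..n. F n s * of_bool (s < T * i div n))" by (rule sum.swap)
  also have "\<dots> = (\<Sum>s<T. F n s * of_nat (c s))"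
  proof (rule sum.cong[OF refl])
    fix s
    have "{1..n} \<inter> {i. s < T * i div n} = {i \<in> {1..n}. s < T * i div n}" by blast
    then show "(\<Sum>i = 1..n. F n s * of_bool (s < T * i div n)) = F n s * of_nat (c s)"
      unfolding sum_distrib_left[symmetric] c_def
      by (subst sum_of_bool_eq) (simp_all only: finite_atLeastAtMost)
  qed
  finally have "(\<Sum>i = 1..n. G n (T * i div n)) + (\<Sum>s<T. of_nat n * of_nat s * F n s) / of_nat T
      = (\<Sum>s<T. F n s * of_nat (c s)) - of_nat n * (\<Sum>s<T. F n s)
        + (\<Sum>s<T. of_nat n * of_nat s * F n s) / of_nat T"
    by (simp only: sum_F_zero) simp
  also have "\<dots> = (\<Sum>s<T. F n s * of_nat (c s) - of_nat n * F n s + of_nat n * of_nat s * F n s / of_nat T)"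
    by (simp only: sum_distrib_left sum_divide_distrib sum_subtractf sum.distrib)
  also have "\<dots> = (\<Sum>s<T. F n s * of_real (real (c s) - (real n - real n * real s / real T)))"
    by (rule sum.cong[OF refl]) (simp add: algebra_simps)
  also have "cmod \<dots> \<le> (\<Sum>s<T. 3)"
  proof (rule sum_norm_le)
    fix s assume "s \<in> {..<T}"
    then have "\<bar>real (c s) - (real n - real n * real s / real T)\<bar> \<le> 1"
      unfolding c_def using card_grid[OF assms] by blast
    then show "cmod (F n s * of_real (real (c s) - (real n - real n * real s / real T))) \<le> 3"
      unfolding norm_mult norm_of_real using mult_mono[OF norm_F_le] by fastforce
  qed
  finally show ?thesis by simp
qed

lemma G_points_zero: "(\<Sum>n = 1..<2 ^ m. \<Sum>i = 1..n. G n (y i)) = 0"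
proof -
  have "(\<Sum>n = 1..<2 ^ m. \<Sum>i = 1..n. G n (y i)) = (\<Sum>n = 1..<2 ^ m. \<Sum>i \<in> {i \<in> {1..<2 ^ m}. i \<le> n}. G n (y i))"
    by (intro sum.cong) auto
  also have "\<dots> = (\<Sum>i = 1..<2 ^ m. \<Sum>n \<in> {n \<in> {1..<2 ^ m}. i \<le> n}. G n (y i))"
    by (rule sum.swap_restrict) auto
  also have "\<dots> = (\<Sum>i = 1..<2 ^ m. \<Sum>n = i..<2 ^ m. G n (y i))"
    by (intro sum.cong) auto
  finally show ?thesis unfolding G_def sum_F_point by simp
qed

text \<open>The matching pairs points with targets, and \<open>G\<close> is Lipschitz. Rounding
  costs at most 1 per pair, hence \<open>3 * n \<le> 3 * T\<close> in all; \<open>G_grid\<close>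
  adds another \<open>3 * T\<close>, which explains the 6.\<close>

lemma transport_ge:
  fixes x :: "nat \<Rightarrow> real"
  assumes y: "\<And>k. y k = nat \<lfloor>real T * x k\<rfloor>" and x: "\<And>k. 1 \<le> k \<Longrightarrow> 0 \<le> x k"
    and n: "1 \<le> n" "n \<le> T" and p: "p permutes {1..n}"
  shows "cmod ((\<Sum>i = 1..n. G n (y i)) + (\<Sum>s<T. of_nat n * of_nat s * F n s) / of_nat T)
    \<le> (3 * (\<Sum>i = 1..n. \<bar>x (p i) - real i / real n\<bar>) + 6) * real T"
proof -
  let ?S = "\<Sum>i = 1..n. \<bar>x (p i) - real i / real n\<bar>"
  have "(\<Sum>i = 1..n. G n (y i)) = (\<Sum>i = 1..n. G n (y (p i)))"
    using sum.permute[OF p, of "\<lambda>i. G n (y i)"] by (simp add: comp_def)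
  then have "cmod ((\<Sum>i = 1..n. G n (y i)) - (\<Sum>i = 1..n. G n (T * i div n)))
    = cmod (\<Sum>i = 1..n. G n (y (p i)) - G n (T * i div n))"
    by (simp add: sum_subtractf)
  also have "\<dots> \<le> (\<Sum>i = 1..n. 3 * (real T * \<bar>x (p i) - real i / real n\<bar> + 1))"
  proof (rule sum_norm_le)
    fix i assume i: "i \<in> {1..n}"
    have "p i \<in> {1..n}" using permutes_in_image[OF p] i by blast
    then have "0 \<le> real T * x (p i)" using x by simp
    then have a: "real (y (p i)) = of_int \<lfloor>real T * x (p i)\<rfloor>" unfolding y by simp
    have b: "real (T * i div n) = of_int \<lfloor>real T * (real i / real n)\<rfloor>"
      using floor_divide_of_nat_eq[of "T * i" n, where ?'a = real] by simp
    have "\<bar>real (y (p i)) - real (T * i div n)\<bar> \<le> \<bar>real T * x (p i) - real T * (real i / real n)\<bar> + 1"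
      unfolding a b by linarith
    also have "\<bar>real T * x (p i) - real T * (real i / real n)\<bar> = real T * \<bar>x (p i) - real i / real n\<bar>"
      by (simp only: right_diff_distrib[symmetric] abs_mult abs_of_nat)
    finally have "3 * \<bar>real (y (p i)) - real (T * i div n)\<bar> \<le> 3 * (real T * \<bar>x (p i) - real i / real n\<bar> + 1)"
      by (rule mult_left_mono) simp
    with G_lipschitz show "cmod (G n (y (p i)) - G n (T * i div n)) \<le> 3 * (real T * \<bar>x (p i) - real i / real n\<bar> + 1)"
      by (rule order_trans)
  qed
  also have "\<dots> = 3 * ?S * real T + 3 * real n"
    by (simp add: sum.distrib sum_distrib_left[symmetric] algebra_simps)
  finally have 1: "cmod ((\<Sum>i = 1..n. G n (y i)) - (\<Sum>i = 1..n. G n (T * i div n))) \<le> 3 * ?S * real T + 3 * real n" .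
  have "cmod ((\<Sum>i = 1..n. G n (y i)) + (\<Sum>s<T. of_nat n * of_nat s * F n s) / of_nat T)
    \<le> (3 * ?S * real T + 3 * real n) + 3 * real T"
    using norm_triangle_mono[OF 1 G_grid[OF n]] by simp
  also have "\<dots> \<le> (3 * ?S * real T + 3 * real T) + 3 * real T"
    using of_nat_mono[OF n(2), where ?'a = real] by (intro add_mono mult_left_mono order_refl) simp_all
  also have "\<dots> = (3 * ?S + 6) * real T" by (simp add: algebra_simps)
  finally show ?thesis .
qed

text \<open>Summed over all prefixes the points contribute zero, so uniformly small costs would
  contradict the lower bound for the volume term.\<close>

lemma exists_costly_prefix:
  fixes x E :: "nat \<Rightarrow> real"
  assumes y: "\<And>k. y k = nat \<lfloor>real T * x k\<rfloor>" and x: "\<And>k. 1 \<le> k \<Longrightarrow> 0 \<le> x k"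
    and E: "\<And>n. 1 \<le> n \<Longrightarrow> \<exists>p. p permutes {1..n} \<and> E n = (\<Sum>i = 1..n. \<bar>x (p i) - real i / real n\<bar>)"
  shows "\<exists>n. 1 \<le> n \<and> n < 2 ^ m \<and> sqrt (real m) / 192 - 3 < E n"
proof (rule ccontr)
  \<comment> \<open>Chosen so that \<open>16 * (3 * ?e + 6)\<close> equals
    \<open>sqrt m / 4 - 48\<close>, below the required \<open>sqrt m / 4 - 1\<close>.\<close>
  let ?e = "sqrt (real m) / 192 - 3"
  let ?v = "\<lambda>n. \<Sum>s<T. of_nat n * of_nat s * F n s"
  assume "\<not> ?thesis"
  then have small: "E n \<le> ?e" if "1 \<le> n" "n < 2 ^ m" for n using that by force
  \<comment> \<open>Nonnegativity of the bound is needed to replace \<open>2 ^ m - 1\<close>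
    prefixes by \<open>2 ^ m\<close>.\<close>
  have "0 \<le> E 1" using E[of 1] by (auto intro: sum_nonneg)
  moreover have "(1::nat) < 2 ^ m" using m_pos by (intro one_less_power) auto
  ultimately have e: "0 \<le> ?e" using small[of 1] by linarith
  have "(\<Sum>n<2 ^ m. ?v n) = (\<Sum>n = 1..<2 ^ m. ?v n)"
    unfolding lessThan_atLeast0 by (subst sum.atLeast_Suc_lessThan) auto
  then have "cmod (\<Sum>n<2 ^ m. ?v n) / real T = cmod (\<Sum>n = 1..<2 ^ m. (\<Sum>i = 1..n. G n (y i)) + ?v n / of_nat T)"
    unfolding sum.distrib G_points_zero by (simp add: norm_divide norm_mult norm_power flip: sum_divide_distrib)
  also have "\<dots> \<le> (\<Sum>n = 1..<(2::nat) ^ m. (3 * ?e + 6) * real T)"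
  proof (rule sum_norm_le)
    fix n :: nat assume n: "n \<in> {1..<2 ^ m}"
    then obtain p where p: "p permutes {1..n}" "E n = (\<Sum>i = 1..n. \<bar>x (p i) - real i / real n\<bar>)"
      using E[of n] by auto
    have "cmod ((\<Sum>i = 1..n. G n (y i)) + ?v n / of_nat T) \<le> (3 * E n + 6) * real T"
      unfolding p(2) using n by (intro transport_ge y x p(1)) auto
    also have "\<dots> \<le> (3 * ?e + 6) * real T"
      using small[of n] n by (intro mult_right_mono) auto
    finally show "cmod ((\<Sum>i = 1..n. G n (y i)) + ?v n / of_nat T) \<le> (3 * ?e + 6) * real T" .
  qed
  also have "\<dots> = (2 ^ m - 1) * ((3 * ?e + 6) * real T)" by (simp add: of_nat_diff)
  also have "\<dots> \<le> 2 ^ m * ((3 * ?e + 6) * real T)" using e by (intro mult_right_mono) auto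
  finally have "cmod (\<Sum>n<2 ^ m. ?v n) \<le> 2 ^ m * ((3 * ?e + 6) * real T) * real T"
    by (simp add: divide_le_eq)
  with volume_F_ge have "8 ^ m * (sqrt (real m) / 4 - 1) \<le> 2 ^ m * ((3 * ?e + 6) * real T) * real T"
    by (rule order_trans)
  also have "\<dots> = 8 ^ m * (16 * (3 * ?e + 6))"
  proof -
    have "(8::real) ^ m = 2 ^ m * 2 ^ m * 2 ^ m" by (simp add: power_mult_distrib[symmetric])
    then show ?thesis by simp
  qed
  finally have "sqrt (real m) / 4 - 1 \<le> 16 * (3 * ?e + 6)" by simp
  then show False by simp
qed

end

section \<open>Infinitely many costly prefixes\<close>

theorem theorem2:
  shows "\<exists>c::real. c > 0 \<and>
    (\<forall>x :: nat \<Rightarrow> real. (\<forall>k\<ge>1. x k \<in> {0..1}) \<longrightarrow>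
      infinite {n::nat. n \<ge> 1 \<and>
        Min ((\<lambda>\<pi>. \<Sum>i=1..n. \<bar>x (\<pi> i) - real i / real n\<bar>) ` {\<pi>. \<pi> permutes {1..n}})
          \<ge> c * sqrt (ln (real n))})"
proof (intro exI[of _ "1 / 400"] conjI allI impI)
  fix x :: "nat \<Rightarrow> real"
  assume x: "\<forall>k\<ge>1. x k \<in> {0..1}"
  define cost where "cost n p = (\<Sum>i = 1..n. \<bar>x (p i) - real i / real n\<bar>)" for n p
  define E where "E n = Min (cost n ` {p. p permutes {1..n}})" for n
  have fin: "finite (cost n ` {p. p permutes {1..n}})" for n
    by (intro finite_imageI finite_permutations) simp
  have attained: "\<exists>p. p permutes {1..n} \<and> E n = cost n p" for n
  proof -
    have "cost n ` {p. p permutes {1..n}} \<noteq> {}" using permutes_id by blast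
    then have "E n \<in> cost n ` {p. p permutes {1..n}}" unfolding E_def using fin by (intro Min_in)
    then show ?thesis by auto
  qed
  have bound: "\<bar>a - b\<bar> \<le> 1" if "0 \<le> a" "a \<le> 1" "0 \<le> b" "b \<le> 1" for a b :: real
    using that by linarith
  \<comment> \<open>Turns a large cost into a large index.\<close>
  have E_le: "E n \<le> real n" for n
  proof -
    have "E n \<le> cost n id"
      unfolding E_def using fin permutes_id by (intro Min_le) blast+
    also have "\<dots> \<le> (\<Sum>i = 1..n. 1)"
      unfolding cost_def
    proof (rule sum_mono)
      fix i assume i: "i \<in> {1..n}"
      then have "0 \<le> real i / real n" "real i / real n \<le> 1" by auto
      moreover have "0 \<le> x i" "x i \<le> 1" using x i by auto
      ultimately show "\<bar>x (id i) - real i / real n\<bar> \<le> 1"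
        unfolding id_apply using bound by blast
    qed
    finally show ?thesis by simp
  qed
  let ?A = "{n. n \<ge> 1 \<and> 1 / 400 * sqrt (ln (real n)) \<le> E n}"
  have "infinite ?A"
  proof
    assume "finite ?A"
    then obtain B where B: "\<And>n. n \<in> ?A \<Longrightarrow> n \<le> B"
      using finite_nat_set_iff_bounded_le[of ?A] by auto
    \<comment> \<open>The summand 1200 gives \<open>K / 400 \<le> K / 192 - 3\<close>, and
      \<open>192 * (B + 3)\<close> pushes the cost, hence \<open>n\<close>, beyond \<open>B\<close>.
      Taking \<open>m\<close> to be a square makes \<open>sqrt m\<close> equal to
      \<open>K\<close>.\<close>
    define K where "K = 1200 + 192 * (B + 3)"
    define m where "m = K\<^sup>2"
    interpret riesz_product "\<lambda>k. nat \<lfloor>real (4 * 2 ^ m) * x k\<rfloor>" m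
      by unfold_locales (simp add: m_def K_def)
    have sqrt_m: "sqrt (real m) = real K" by (simp add: m_def)
    obtain n where n: "1 \<le> n" "n < 2 ^ m" "sqrt (real m) / 192 - 3 < E n"
      using exists_costly_prefix[of x E] x attained unfolding cost_def by auto
    have "real n \<le> 2 ^ m" using n(2) by (metis less_imp_le of_nat_le_iff of_nat_numeral of_nat_power)
    then have "ln (real n) \<le> ln (2 ^ m)" using n(1) by simp
    also have "\<dots> = real m * ln 2" by (simp add: ln_realpow)
    also have "\<dots> \<le> real m * 1" using ln_2_less_1 by (intro mult_left_mono) auto
    finally have "sqrt (ln (real n)) \<le> real K" using sqrt_m real_sqrt_le_mono by fastforce
    also have "real K / 400 \<le> real K / 192 - 3" by (simp add: K_def)
    ultimately have "n \<in> ?A" using n sqrt_m by auto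
    moreover have "real B \<le> real K / 192 - 3" by (simp add: K_def field_simps)
    then have "real B < real n" using n(3) E_le[of n] unfolding sqrt_m by linarith
    ultimately show False using B[of n] by simp
  qed
  then show "infinite {n::nat. n \<ge> 1 \<and>
        Min ((\<lambda>\<pi>. \<Sum>i=1..n. \<bar>x (\<pi> i) - real i / real n\<bar>) ` {\<pi>. \<pi> permutes {1..n}})
          \<ge> 1 / 400 * sqrt (ln (real n))}"
    unfolding E_def cost_def .
qed simp

end
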